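(* Let $X_1$ and $X_2$ be first countable compact Hausdorff spaces. Suppose that a map $T:C(X_1)\to C(X_2)$ is 2-local in $\operatorname{Iso}(C(X_1), C(X_2))$. Then $T \in \operatorname{Iso}(C(X_1), C(X_2))$.
   Context: $C(X)$ is the Banach algebra of all complex-valued continuous functions on the compact Hausdorff space $X$, with the supremum norm. For normed spaces $\mathfrak{M}_1,\mathfrak{M}_2$, $\operatorname{Iso}(\mathfrak{M}_1,\mathfrak{M}_2)$ is the set of all surjective isometries (distance preserving maps, not necessarily linear) from $\mathfrak{M}_1$ onto $\mathfrak{M}_2$. A map $T:\mathfrak{M}_1\to\mathfrak{M}_2$ (no linearity, continuity or surjectivity assumed) is 2-local in $\operatorname{Iso}(\mathfrak{M}_1,\mathfrak{M}_2)$ if for every $x,y\in\mathfrak{M}_1$ there is $T_{x,y}\in\operatorname{Iso}(\mathfrak{M}_1,\mathfrak{M}_2)$ such that $T(x)=T_{x,y}(x)$ and $T(y)=T_{x,y}(y)$. *)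

theory Defs
  imports "HOL-Analysis.Analysis"
begin

text \<open>The set of all surjective isometries between two normed spaces; they need not be linear.\<close>

definition Iso :: "('a::real_normed_vector \<Rightarrow> 'b::real_normed_vector) set" where
  "Iso = {S. surj S \<and> (\<forall>f g. dist (S f) (S g) = dist f g)}"

definition two_local_in :: "('a \<Rightarrow> 'b) set \<Rightarrow> ('a \<Rightarrow> 'b) \<Rightarrow> bool" where
  "two_local_in \<S> T \<longleftrightarrow> (\<forall>f g. \<exists>S\<in>\<S>. T f = S f \<and> T g = S g)"

text \<open>
  For a (necessarily nonempty) compact space, given as a type whose universe is compact, the
  Banach space of all complex-valued continuous functions with the supremum norm is the library
  type of bounded continuous functions: boundedness is automatic. The following facts record this.
\<close>

type_synonym 'x C = "'x \<Rightarrow>\<^sub>C complex"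

lemma range_apply_bcontfun_compact:
  assumes "compact (UNIV :: 'x::topological_space set)"
  shows "range (apply_bcontfun :: 'x C \<Rightarrow> 'x \<Rightarrow> complex) = {f. continuous_on UNIV f}"
proof -
  have "f \<in> bcontfun" if "continuous_on UNIV f" for f :: "'x \<Rightarrow> complex"
    using compact_continuous_image[OF that assms] that
    by (simp add: bcontfun_def compact_imp_bounded)
  then show ?thesis
    by (auto intro: rangeI elim!: bcontfunE)
qed

lemma norm_C_eq_SUP:
  fixes f :: "'x::topological_space C"
  shows "norm f = (SUP x. cmod (apply_bcontfun f x))"
  by (simp add: norm_bcontfun_def dist_bcontfun.rep_eq)

end

theory Submission
  imports Defs
begin

text \<open>
  By Mazur--Ulam and a Banach--Stone argument with peak functions, every surjective isometry \<open>S\<close>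
  satisfies \<open>\<bar>S f - S g\<bar> = \<bar>f - g\<bar> \<circ> \<phi>\<close> for a bijection \<open>\<phi>\<close>, so for a 2-local \<open>T\<close> the same
  holds with \<open>\<phi>\<close> depending on \<open>f\<close> and \<open>g\<close>. Fix a point \<open>y\<close>. On constants \<open>f \<mapsto> T f y\<close> is an
  isometry of the plane; undoing it gives a functional \<open>F\<close> fixing the constants with
  \<open>\<bar>F f - F g\<bar>\<close> in the range of \<open>\<bar>f - g\<bar>\<close>. As \<open>z \<mapsto> F (f + z)\<close> is a plane isometry at bounded
  distance from the identity, \<open>F (f + z) = F f + z\<close>, and hence \<open>F f - F g\<close> lies in the range of
  \<open>f - g\<close>. This implies that \<open>F\<close> is additive on real functions and kills \<open>\<bar>f - F f\<bar>\<^sup>2\<close> for every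
  \<open>f\<close>, so by compactness all \<open>f - F f\<close> have a common zero \<open>\<phi> y\<close> and \<open>F\<close> is evaluation there.
  Functions with a single zero, which exist by first countability, show that \<open>\<phi>\<close> is a
  homeomorphism, and then \<open>T f = g\<close> can be solved pointwise.
\<close>

subsection \<open>Functionals with a range condition\<close>

lemma bounded_linear_map_eq_zero:
  fixes k :: "'a::real_vector \<Rightarrow> 'b::real_normed_vector"
  assumes "linear k" "\<And>z. norm (k z) \<le> B"
  shows "k z = 0"
proof (rule ccontr)
  assume nz: "k z \<noteq> 0"
  have "norm (k (((B + 1) / norm (k z)) *\<^sub>R z)) = \<bar>B + 1\<bar>"
    using nz by (simp add: linear_scale[OF assms(1)])
  with assms(2)[of "((B + 1) / norm (k z)) *\<^sub>R z"] show False by linarith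
qed

text \<open>A distance preserving map of an inner product space that fixes 0 is linear, onto or not.
  So \<open>h - h 0\<close> minus the identity is linear with bounded range, hence zero.\<close>

lemma plane_isometry_near_identity:
  fixes h :: "complex \<Rightarrow> complex"
  assumes iso: "\<And>z w. dist (h z) (h w) = dist z w" and near: "\<And>z. cmod (h z - z) \<le> B"
  shows "h z = h 0 + z"
proof -
  have "linear (\<lambda>z. h z - h 0)"
    by (rule isometry_linear) (use iso in \<open>auto simp: dist_norm\<close>)
  then have "linear (\<lambda>z. h z - h 0 - z)"
    using linear_compose_sub linear_ident by blast
  moreover have "cmod (h z - h 0 - z) \<le> B + cmod (h 0)" for z
    using near[of z] norm_triangle_ineq4[of "h z - z" "h 0"] by (simp add: algebra_simps)
  ultimately have "h z - h 0 - z = 0" by (rule bounded_linear_map_eq_zero)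
  then show ?thesis by (simp add: algebra_simps)
qed

text \<open>By the previous lemma, adding a constant to \<open>g\<close> adds it to
  \<open>F g\<close>. For the constant \<open>F f - F g\<close> the two values of \<open>F\<close>
  coincide, so the modulus in \<open>sph\<close> is zero and hides no phase.\<close>

lemma spherical_range_imp_range:
  fixes F :: "('x::topological_space \<Rightarrow> complex) \<Rightarrow> complex"
  assumes comp: "compact (UNIV :: 'x set)"
    and const: "\<And>c. F (\<lambda>_. c) = c"
    and sph: "\<And>f g. continuous_on UNIV f \<Longrightarrow> continuous_on UNIV g \<Longrightarrow>
               \<exists>x. cmod (F f - F g) = cmod (f x - g x)"
    and f: "continuous_on UNIV f" and g: "continuous_on UNIV g"
  shows "\<exists>x. F f - F g = f x - g x"
proof -
  define h where "h z = F (\<lambda>x. g x + z)" for z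
  have gz: "continuous_on UNIV (\<lambda>x. g x + z)" for z
    by (intro continuous_intros g)
  have "compact (range g)"
    using compact_continuous_image[OF g comp] .
  then obtain B where B: "\<And>x. cmod (g x) \<le> B"
    using compact_imp_bounded bounded_iff by (metis rangeI)
  have iso: "dist (h z) (h w) = dist z w" for z w
    using sph[OF gz[of z] gz[of w]] by (simp add: h_def dist_norm)
  have near: "cmod (h z - z) \<le> B" for z
    using sph[OF gz[of z] continuous_on_const[of UNIV z]] B by (auto simp: h_def const)
  have "h (F f - F g) = F f"
    using plane_isometry_near_identity[OF iso near, of "F f - F g"] by (simp add: h_def)
  moreover obtain x where "cmod (F f - h (F f - F g)) = cmod (f x - (g x + (F f - F g)))"
    using sph[OF f gz] unfolding h_def by blast
  ultimately have "F f - F g = f x - g x"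
    by (simp add: algebra_simps)
  then show ?thesis ..
qed

text \<open>This is the Kowalski-Slodkowski theorem for continuous functions on a compact space,
  where the spectrum of a function is its range.\<close>

lemma range_condition_imp_evaluation:
  fixes F :: "('x::topological_space \<Rightarrow> complex) \<Rightarrow> complex"
  assumes comp: "compact (UNIV :: 'x set)"
    and const: "\<And>c. F (\<lambda>_. c) = c"
    and range: "\<And>f g. continuous_on UNIV f \<Longrightarrow> continuous_on UNIV g \<Longrightarrow>
               \<exists>x. F f - F g = f x - g x"
  shows "\<exists>x. \<forall>f. continuous_on UNIV f \<longrightarrow> F f = f x"
proof -
  define P where "P r = Re (F (\<lambda>x. complex_of_real (r x)))" for r
  define Q where "Q s = Im (F (\<lambda>x. \<i> * complex_of_real (s x)))" for s
  \<comment> \<open>Replacing \<open>f\<close> by its real part changes it by purely imaginary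
    values, so the range condition keeps \<open>Re (F f)\<close>; dually for
    \<open>Im\<close>.\<close>
  have ReF: "Re (F f) = P (\<lambda>x. Re (f x))" and ImF: "Im (F f) = Q (\<lambda>x. Im (f x))"
    if f: "continuous_on UNIV f" for f
  proof -
    obtain x where "F f - F (\<lambda>x. complex_of_real (Re (f x))) = f x - Re (f x)"
      using range[OF f, of "\<lambda>x. complex_of_real (Re (f x))"] f by (auto intro!: continuous_intros)
    then show "Re (F f) = P (\<lambda>x. Re (f x))"
      by (simp add: P_def complex_eq_iff)
    have "continuous_on UNIV (\<lambda>x. \<i> * complex_of_real (Im (f x)))"
      by (intro continuous_intros f)
    from range[OF f this]
    obtain x where "F f - F (\<lambda>x. \<i> * complex_of_real (Im (f x))) = f x - \<i> * Im (f x)"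
      by blast
    then show "Im (F f) = Q (\<lambda>x. Im (f x))"
      by (simp add: Q_def complex_eq_iff)
  qed
  have PQ: "\<exists>x. P r1 - P r2 = r1 x - r2 x \<and> Q s1 - Q s2 = s1 x - s2 x"
    if "continuous_on UNIV r1" "continuous_on UNIV r2" "continuous_on UNIV s1" "continuous_on UNIV s2"
    for r1 r2 s1 s2
  proof -
    have c: "continuous_on UNIV (\<lambda>x. Complex (r1 x) (s1 x))" "continuous_on UNIV (\<lambda>x. Complex (r2 x) (s2 x))"
      using that by (auto intro!: continuous_intros simp: Complex_eq)
    obtain x where "F (\<lambda>x. Complex (r1 x) (s1 x)) - F (\<lambda>x. Complex (r2 x) (s2 x))
        = Complex (r1 x) (s1 x) - Complex (r2 x) (s2 x)"
      using range[OF c] by blast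
    then show ?thesis
      using ReF[OF c(1)] ReF[OF c(2)] ImF[OF c(1)] ImF[OF c(2)]
      by (auto simp: complex_eq_iff)
  qed
  have Pc: "P (\<lambda>_. c) = c" for c
    by (simp add: P_def const)
  have Q0: "Q (\<lambda>_. 0) = 0"
    by (simp add: Q_def const)
  \<comment> \<open>One point \<open>x\<close> serves the real and the imaginary parts simultaneously; applied to the pairs
    \<open>f + g, g\<close> and \<open>f, 0\<close> this forces additivity.\<close>
  have add: "P (\<lambda>x. f x + g x) = P f + P g"
    if f: "continuous_on UNIV f" and g: "continuous_on UNIV g" for f g
  proof -
    have 1: "P (\<lambda>x. f x + g x) = P g + Q f" if g: "continuous_on UNIV g" for g
      using PQ[OF continuous_on_add[OF f g] g f continuous_on_const[of UNIV 0]] Q0 by auto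
    from 1[OF g] 1[OF continuous_on_const, of 0] show ?thesis
      by (simp add: Pc)
  qed
  have PQ_eq: "Q f = P f" if f: "continuous_on UNIV f" for f
    using PQ[OF f continuous_on_const[of UNIV 0] f continuous_on_const[of UNIV 0]] Pc[of 0] Q0 by auto
  \<comment> \<open>With the square as real part and \<open>r\<close> as imaginary part, a common
    point \<open>x\<close> has \<open>P\<close> of the square equal to the square of
    \<open>r x\<close>, and \<open>r x = Q r = P r = 0\<close>.\<close>
  have square: "P (\<lambda>x. (r x)\<^sup>2) = 0" if r: "continuous_on UNIV r" and "P r = 0" for r
    using PQ[OF continuous_on_power[OF r, of 2] continuous_on_const[of UNIV 0]
        r continuous_on_const[of UNIV 0]] that Pc[of 0] Q0 PQ_eq[OF r] by auto
  \<comment> \<open>A sum of the nonnegative functions \<open>k f\<close> vanishes exactly at the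
    common zeros of the \<open>f - F f\<close>, so additivity of \<open>P\<close> on real functions
    controls finitely many \<open>f\<close> at once.\<close>
  define k where "k f x = (cmod (f x - F f))\<^sup>2" for f x
  have kc: "continuous_on UNIV (k f)" if "continuous_on UNIV f" for f
    unfolding k_def[abs_def] by (intro continuous_intros that)
  have Pk: "P (k f) = 0" if f: "continuous_on UNIV f" for f
  proof -
    let ?a = "\<lambda>x. Re (f x) + - Re (F f)" and ?b = "\<lambda>x. Im (f x) + - Im (F f)"
    have a: "continuous_on UNIV ?a" and b: "continuous_on UNIV ?b"
      by (intro continuous_intros f)+
    have "P ?a = 0"
      using ReF[OF f] f by (subst add) (auto intro!: continuous_intros simp: Pc)
    moreover have "P ?b = 0"
      using ImF[OF f] PQ_eq[OF continuous_on_Im[OF f]] f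
      by (subst add) (auto intro!: continuous_intros simp: Pc)
    ultimately have "P (\<lambda>x. (?a x)\<^sup>2 + (?b x)\<^sup>2) = 0"
      using square[OF a] square[OF b] a b by (subst add) (auto intro!: continuous_intros)
    moreover have "k f = (\<lambda>x. (?a x)\<^sup>2 + (?b x)\<^sup>2)"
      by (auto simp: k_def cmod_power2)
    ultimately show ?thesis by simp
  qed
  have Psum: "P (\<lambda>x. \<Sum>f\<in>B. k f x) = 0" if "finite B" "\<forall>f\<in>B. continuous_on UNIV f" for B
    using that
  proof (induction B)
    case (insert f B)
    then have "P (\<lambda>x. k f x + (\<Sum>f\<in>B. k f x)) = 0"
      using Pk[of f] by (subst add) (auto intro!: continuous_intros kc)
    with insert show ?case by simp
  qed (simp add: Pc)
  define Z where "Z f = {x. f x = F f}" for f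
  have "UNIV \<inter> \<Inter> (Z ` {f. continuous_on UNIV f}) \<noteq> {}"
  proof (rule compact_imp_fip[OF comp])
    fix T assume "T \<in> Z ` {f. continuous_on UNIV f}"
    then show "closed T"
      by (auto simp: Z_def intro!: closed_Collect_eq)
  next
    fix \<Z> assume "finite \<Z>" "\<Z> \<subseteq> Z ` {f. continuous_on UNIV f}"
    then obtain B where B: "B \<subseteq> {f. continuous_on UNIV f}" "finite B" "\<Z> = Z ` B"
      by (meson finite_subset_image)
    have c: "continuous_on UNIV (\<lambda>x. \<Sum>f\<in>B. k f x)"
      using B by (auto intro!: continuous_intros kc)
    have "P (\<lambda>x. \<Sum>f\<in>B. k f x) = 0"
      by (rule Psum) (use B in auto)
    then obtain x where "(\<Sum>f\<in>B. k f x) = 0"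
      using PQ[OF c continuous_on_const[of UNIV 0] c continuous_on_const[of UNIV 0]] Pc[of 0] by auto
    then have "\<forall>f\<in>B. k f x = 0"
      using B(2) by (subst (asm) sum_nonneg_eq_0_iff) (auto simp: k_def)
    then have "x \<in> \<Inter>\<Z>"
      by (auto simp: B(3) Z_def k_def)
    then show "UNIV \<inter> \<Inter>\<Z> \<noteq> {}" by blast
  qed
  then obtain x where "\<forall>f. continuous_on UNIV f \<longrightarrow> x \<in> Z f"
    by auto
  then show ?thesis
    by (auto simp: Z_def intro!: exI[of _ x])
qed

subsection \<open>The Mazur--Ulam theorem\<close>

lemma Iso_iff: "S \<in> Iso \<longleftrightarrow> surj S \<and> (\<forall>f g. dist (S f) (S g) = dist f g)"
  by (simp add: Iso_def)

lemma Iso_inj: "S \<in> Iso \<Longrightarrow> inj S"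
  unfolding Iso_def inj_def by (metis (mono_tags, lifting) dist_eq_0_iff mem_Collect_eq)

lemma Iso_comp: "S \<in> Iso \<Longrightarrow> R \<in> Iso \<Longrightarrow> S \<circ> R \<in> Iso"
  using comp_surj[of R S] by (simp add: Iso_iff comp_def)

lemma Iso_inv: "S \<in> Iso \<Longrightarrow> inv S \<in> Iso"
  using Iso_inj[of S] by (auto simp: Iso_iff inj_imp_surj_inv) (metis surj_f_inv_f)

lemma Iso_reflection: "(\<lambda>x. c - x) \<in> Iso"
  unfolding Iso_iff
  by (auto simp: dist_norm norm_minus_commute intro!: surjI[of _ "\<lambda>x. c - x"])

text \<open>
  Vaisala's argument: conjugating with the reflection in the midpoint turns \<open>g\<close> into another
  isometry fixing \<open>a\<close> and \<open>b\<close> that displaces the midpoint twice as far. Such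
  displacements are bounded, so they vanish.
\<close>

lemma Iso_fixes_midpoint:
  fixes a b :: "'a::real_normed_vector"
  assumes "g \<in> Iso" "g a = a" "g b = b"
  shows "g (midpoint a b) = midpoint a b"
proof -
  define z where "z = midpoint a b"
  define W :: "('a \<Rightarrow> 'a) set" where "W = {g \<in> Iso. g a = a \<and> g b = b}"
  define \<rho> where "\<rho> = (\<lambda>x. (a + b) - x)"
  define l where "l = (SUP g\<in>W. dist (g z) z)"
  have \<rho>: "\<rho> \<in> Iso" "\<rho> a = b" "\<rho> b = a" "\<rho> (\<rho> x) = x" "\<rho> z = z" "dist (\<rho> x) x = 2 * dist x z" for x
  proof -
    show "\<rho> \<in> Iso" unfolding \<rho>_def by (rule Iso_reflection)
    show z: "\<rho> z = z"
      by (simp add: \<rho>_def z_def midpoint_def algebra_simps flip: scaleR_add_left)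
    have "\<rho> x - x = (-2) *\<^sub>R (x - z)"
      by (simp add: \<rho>_def z_def midpoint_def algebra_simps scaleR_2)
    then show "dist (\<rho> x) x = 2 * dist x z" by (simp add: dist_norm)
  qed (auto simp: \<rho>_def)
  have bdd: "bdd_above ((\<lambda>g. dist (g z) z) ` W)"
  proof (intro bdd_aboveI2)
    fix g assume "g \<in> W"
    then have "dist (g z) a = dist z a" by (auto simp: W_def Iso_iff) metis
    then show "dist (g z) z \<le> 2 * dist z a"
      using dist_triangle2[of "g z" z a] by simp
  qed
  have double: "2 * dist (g z) z \<le> l" if g: "g \<in> W" for g
  proof -
    have gI: "g \<in> Iso" using g by (simp add: W_def)
    have inv: "inv g a = a" "inv g b = b" "inv g (g x) = x" for x
      using g Iso_inj[OF gI] by (auto simp: W_def inv_f_eq)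
    have "\<rho> \<circ> inv g \<circ> \<rho> \<circ> g \<in> W"
      using g by (auto simp: W_def inv \<rho> intro!: Iso_comp Iso_inv)
    then have "dist ((\<rho> \<circ> inv g \<circ> \<rho> \<circ> g) z) z \<le> l"
      unfolding l_def using bdd by (rule cSUP_upper)
    also have "dist ((\<rho> \<circ> inv g \<circ> \<rho> \<circ> g) z) z = dist (\<rho> (inv g (\<rho> (g z)))) (\<rho> z)"
      by (simp add: \<rho>)
    also have "\<dots> = dist (inv g (\<rho> (g z))) (inv g (g z))"
      using \<rho>(1) by (simp add: Iso_iff inv)
    also have "\<dots> = 2 * dist (g z) z"
      using Iso_inv[OF gI] \<rho>(6) by (simp add: Iso_iff)
    finally show ?thesis .
  qed
  have W: "g \<in> W" using assms by (simp add: W_def)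
  \<comment> \<open>By \<open>double\<close> every displacement is at most \<open>l / 2\<close>,
    hence so is their supremum \<open>l\<close>; thus \<open>l\<close> is not positive.\<close>
  then have "l \<le> l / 2"
    unfolding l_def by (intro cSUP_least) (use double in \<open>auto simp: l_def\<close>, fastforce)
  with double[OF W] have "dist (g z) z = 0"
    using zero_le_dist[of "g z" z] by linarith
  then show ?thesis by (simp add: z_def)
qed

text \<open>Conjugating by \<open>S\<close> the reflection that swaps \<open>S a\<close> and
  \<open>S b\<close>, then reflecting to swap \<open>a\<close> and \<open>b\<close>, gives an
  isometry fixing \<open>a\<close> and \<open>b\<close>, hence their midpoint. So
  \<open>\<sigma>\<close> fixes the image of the midpoint, and its only fixed point is the midpoint
  of \<open>S a\<close> and \<open>S b\<close>.\<close>

lemma Iso_midpoint: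
  fixes S :: "'a::real_normed_vector \<Rightarrow> 'b::real_normed_vector"
  assumes S: "S \<in> Iso"
  shows "S (midpoint a b) = midpoint (S a) (S b)"
proof -
  define \<rho> where "\<rho> = (\<lambda>x. (a + b) - x)"
  define \<sigma> where "\<sigma> = (\<lambda>y. (S a + S b) - y)"
  have I: "\<rho> \<in> Iso" "\<sigma> \<in> Iso" unfolding \<rho>_def \<sigma>_def by (rule Iso_reflection)+
  have inv: "inv S (S x) = x" for x using Iso_inj[OF S] by simp
  have \<rho>: "\<rho> (midpoint a b) = midpoint a b"
    by (simp add: \<rho>_def midpoint_def algebra_simps flip: scaleR_add_left)
  have "(\<rho> \<circ> inv S \<circ> \<sigma> \<circ> S) (midpoint a b) = midpoint a b"
    by (intro Iso_fixes_midpoint Iso_comp I S Iso_inv) (auto simp: \<rho>_def \<sigma>_def inv)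
  then have "\<rho> (\<rho> (inv S (\<sigma> (S (midpoint a b))))) = midpoint a b"
    by (simp add: \<rho>)
  then have "inv S (\<sigma> (S (midpoint a b))) = midpoint a b"
    by (simp add: \<rho>_def)
  then have "\<sigma> (S (midpoint a b)) = S (midpoint a b)"
    using S by (metis Iso_iff surj_f_inv_f)
  then have "2 *\<^sub>R S (midpoint a b) = S a + S b"
    by (simp add: \<sigma>_def scaleR_2 algebra_simps)
  then show ?thesis
    by (simp add: midpoint_def flip: \<open>2 *\<^sub>R _ = _\<close>)
qed

text \<open>The homogeneity defect \<open>e\<close> at \<open>t\<close>, multiplied by
  \<open>n\<close>, is the defect at the fractional part of \<open>n * t\<close>, because integer
  multiples have none. That is bounded independently of \<open>n\<close>, so
  \<open>e = 0\<close>.\<close>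

lemma additive_bounded_imp_linear:
  fixes f :: "'a::real_normed_vector \<Rightarrow> 'b::real_normed_vector"
  assumes add: "\<And>x y. f (x + y) = f x + f y" and bound: "\<And>x. norm (f x) \<le> norm x"
  shows "linear f"
proof (rule linearI)
  fix t :: real and x :: 'a
  interpret additive f by standard (rule add)
  have int: "f (of_int m *\<^sub>R x) = of_int m *\<^sub>R f x" for m x
  proof (induction m rule: int_induct[where k = 0])
    case (step1 i) then show ?case by (simp add: scaleR_left_distrib add)
  next
    case (step2 i) then show ?case by (simp add: scaleR_left_diff_distrib diff)
  qed (simp add: zero)
  define e where "e = f (t *\<^sub>R x) - t *\<^sub>R f x"
  have "real n * norm e \<le> 2 * norm x" for n :: nat
  proof -
    define m where "m = \<lfloor>real n * t\<rfloor>"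
    define d where "d = real n * t - of_int m"
    have d: "\<bar>d\<bar> \<le> 1" unfolding d_def m_def by linarith
    have nt: "real n * t = of_int m + d" by (simp add: d_def)
    have "real n *\<^sub>R e = f ((real n * t) *\<^sub>R x) - (real n * t) *\<^sub>R f x"
      using int[of "int n" "t *\<^sub>R x"] by (simp add: e_def algebra_simps)
    also have "\<dots> = f (d *\<^sub>R x) - d *\<^sub>R f x"
      by (simp add: nt scaleR_left_distrib add int)
    finally have "real n * norm e \<le> norm (f (d *\<^sub>R x)) + norm (d *\<^sub>R f x)"
      by (metis norm_scaleR abs_of_nat norm_triangle_ineq4)
    also have "\<dots> \<le> \<bar>d\<bar> * norm x + \<bar>d\<bar> * norm x"
      using bound[of "d *\<^sub>R x"] bound[of x] by (intro add_mono) (auto intro: mult_left_mono)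
    also have "\<dots> \<le> 2 * norm x"
      using mult_right_mono[OF d norm_ge_zero[of x]] by simp
    finally show ?thesis .
  qed
  then have "norm e = 0"
    by (meson norm_ge_zero real_archimedian_rdiv_eq_0 mult_nonneg_nonneg zero_le_numeral)
  then show "f (t *\<^sub>R x) = t *\<^sub>R f x" by (simp add: e_def)
qed (rule add)

lemma Mazur_Ulam:
  fixes S :: "'a::real_normed_vector \<Rightarrow> 'b::real_normed_vector"
  assumes S: "S \<in> Iso"
  shows "linear (\<lambda>x. S x - S 0)"
proof (rule additive_bounded_imp_linear)
  define f where "f x = S x - S 0" for x
  have mid: "f (midpoint x y) = midpoint (f x) (f y)" for x y
    unfolding f_def Iso_midpoint[OF S]
    by (simp add: midpoint_def algebra_simps flip: scaleR_add_left)
  have half: "f ((1/2) *\<^sub>R x) = (1/2) *\<^sub>R f x" for x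
    using mid[of x 0] by (simp add: midpoint_def f_def)
  have "f (x + y) = f x + f y" for x y
    using half[of "x + y"] mid[of x y] by (simp add: midpoint_def)
  then show "S (x + y) - S 0 = (S x - S 0) + (S y - S 0)" for x y by (simp add: f_def)
  show "norm (S x - S 0) \<le> norm x" for x
    using S by (metis Iso_iff diff_zero dist_norm order_refl)
qed

subsection \<open>Peak functions and a Banach--Stone theorem\<close>

lemma apply_Bcontfun:
  fixes f :: "'x::topological_space \<Rightarrow> complex"
  assumes "compact (UNIV :: 'x set)" "continuous_on UNIV f"
  shows "apply_bcontfun (Bcontfun f) = f"
proof -
  have "f \<in> bcontfun"
    using compact_continuous_image[OF assms(2,1)] assms(2)
    by (simp add: bcontfun_def compact_imp_bounded)
  then show ?thesis by (rule Bcontfun_inverse)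
qed

lemma norm_attained:
  fixes f :: "'x::topological_space C"
  assumes "compact (UNIV :: 'x set)"
  obtains x where "cmod (f x) = norm f"
proof -
  have "continuous_on UNIV (\<lambda>x. cmod (f x))" by (intro continuous_intros) simp
  then obtain x where "\<And>y. cmod (f y) \<le> cmod (f x)"
    using continuous_attains_sup[OF assms, of "\<lambda>x. cmod (f x)"] by auto
  then have "norm f = cmod (f x)"
    by (intro antisym norm_bound norm_bounded) 
  then show thesis using that by simp
qed

text \<open>First countability enters here: Urysohn functions that are 0 at \<open>x\<close> and 1
  off the basic neighbourhoods are summed with geometric weights, and each other point lies outside
  some neighbourhood.\<close>

lemma ex_function_vanishing_only_at:
  fixes x :: "'x::{first_countable_topology, t2_space}"
  assumes comp: "compact (UNIV :: 'x set)"
  obtains d :: "'x \<Rightarrow> real" where "continuous_on UNIV d" "\<And>y. 0 \<le> d y" "\<And>y. d y = 0 \<longleftrightarrow> y = x"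
proof -
  have "Hausdorff_space (euclidean :: 'x topology)"
    unfolding Hausdorff_space_def by (auto simp: disjnt_def) (metis hausdorff)
  then have normal: "normal_space (euclidean :: 'x topology)"
    using comp by (intro compact_Hausdorff_or_regular_imp_normal_space)
      (auto simp: compact_space_def)
  obtain A :: "nat \<Rightarrow> 'x set" where A: "\<And>i. x \<in> A i" "\<And>i. open (A i)"
    "\<And>S. open S \<Longrightarrow> x \<in> S \<Longrightarrow> \<exists>i. A i \<subseteq> S"
    using first_countable_basis[of x] by auto
  have "\<exists>f :: 'x \<Rightarrow> real. continuous_on UNIV f \<and> range f \<subseteq> {0..1} \<and> f x = 0 \<and> f ` (- A i) \<subseteq> {1}" for i
  proof -
    obtain f where "continuous_map euclidean (top_of_set {0..1::real}) f" "f ` {x} \<subseteq> {0}" "f ` (- A i) \<subseteq> {1}"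
      by (rule Urysohn_lemma[OF normal, of "{x}" "- A i" 0 1])
        (use A in \<open>auto simp: disjnt_iff closed_Compl\<close>)
    then show ?thesis
      by (intro exI[of _ f]) (auto simp: continuous_map_in_subtopology)
  qed
  then obtain f :: "nat \<Rightarrow> 'x \<Rightarrow> real" where f: "\<And>i. continuous_on UNIV (f i)"
    "\<And>i. range (f i) \<subseteq> {0..1}" "\<And>i. f i x = 0" "\<And>i. f i ` (- A i) \<subseteq> {1}"
    by metis
  have f01: "0 \<le> f i y" "f i y \<le> 1" for i y
    using f(2)[of i] by (auto simp: image_subset_iff)
  define g where "g i y = (1/2)^i * f i y" for i y
  define d where "d y = (\<Sum>i. g i y)" for y
  have g: "0 \<le> g i y" "norm (g i y) \<le> (1/2)^i" for i y
    using f01[of i y] by (auto simp: g_def mult_left_le)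
  have summ: "summable (\<lambda>i. g i y)" for y
    by (rule summable_comparison_test'[of "\<lambda>i. (1/2)^i" 0]) (use g(2) in \<open>auto intro: summable_geometric\<close>)
  have "uniform_limit UNIV (\<lambda>n y. \<Sum>i<n. g i y) d sequentially"
    unfolding d_def by (rule Weierstrass_m_test[of _ _ "\<lambda>i. (1/2)^i"]) (use g(2) in \<open>auto intro: summable_geometric\<close>)
  then have "continuous_on UNIV d"
    by (rule uniform_limit_theorem[rotated])
      (auto simp: g_def intro!: always_eventually continuous_intros f(1))
  moreover have "0 \<le> d y" for y
    unfolding d_def by (intro suminf_nonneg summ g)
  moreover have "d y = 0 \<longleftrightarrow> y = x" for y
  proof
    assume "y = x" then show "d y = 0" by (simp add: d_def g_def f(3))
  next
    assume "d y = 0"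
    then have z: "g i y = 0" for i
      unfolding d_def using suminf_eq_zero_iff[OF summ g(1)] by blast
    show "y = x"
    proof (rule ccontr)
      assume "y \<noteq> x"
      then obtain i where "A i \<subseteq> - {y}"
        using A(3)[of "- {y}"] by (auto simp: open_Compl)
      then have "f i y = 1" using f(4)[of i] by auto
      with z[of i] show False by (simp add: g_def)
    qed
  qed
  ultimately show thesis by (rule that)
qed

lemma ex_peak_function:
  fixes x :: "'x::{first_countable_topology, t2_space}"
  assumes comp: "compact (UNIV :: 'x set)" and l: "cmod l = 1"
  obtains p :: "'x C" where "p x = l" "norm p = 1" "\<And>z. 1 \<le> cmod (p z) \<Longrightarrow> z = x"
proof -
  obtain d :: "'x \<Rightarrow> real" where d: "continuous_on UNIV d" "\<And>y. 0 \<le> d y" "\<And>y. d y = 0 \<longleftrightarrow> y = x"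
    using ex_function_vanishing_only_at[OF comp, of x] by blast
  have pos: "1 + d z > 0" for z
    using d(2)[of z] by simp
  define p where "p = Bcontfun (\<lambda>z. l * complex_of_real (1 / (1 + d z)))"
  have "continuous_on UNIV (\<lambda>z. l * complex_of_real (1 / (1 + d z)))"
    by (intro continuous_intros d(1)) (use pos in \<open>auto simp: less_le\<close>)
  then have p: "p z = l * complex_of_real (1 / (1 + d z))" for z
    unfolding p_def by (simp add: apply_Bcontfun[OF comp])
  have pz: "cmod (p z) = 1 / (1 + d z)" for z
    unfolding p norm_mult norm_of_real using l pos[of z] by simp
  have p_le: "cmod (p z) \<le> 1" for z
    unfolding pz using d(2)[of z] by simp
  have px: "p x = l" using d(3)[of x] by (simp add: p)
  have "norm p = 1"
  proof (rule antisym)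
    show "norm p \<le> 1" by (rule norm_bound) (rule p_le)
    show "1 \<le> norm p" using norm_bounded[of p x] by (simp add: px l)
  qed
  moreover have "z = x" if "1 \<le> cmod (p z)" for z
    using that pos[of z] d(2)[of z] d(3)[of z] by (simp add: pz)
  ultimately show thesis using that px by blast
qed

text \<open>Strict convexity of the disc, by the parallelogram identity.\<close>

lemma eq_if_norm_add_ge_two:
  fixes a b :: complex
  assumes "cmod a \<le> 1" "cmod b \<le> 1" "2 \<le> cmod (a + b)"
  shows "a = b"
proof -
  have "(cmod (a - b))\<^sup>2 = 2 * (cmod a)\<^sup>2 + 2 * (cmod b)\<^sup>2 - (cmod (a + b))\<^sup>2"
    unfolding cmod_power2 by (simp add: power2_eq_square algebra_simps)
  also have "\<dots> \<le> 2 * 1 + 2 * 1 - 2\<^sup>2"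
    using power_mono[OF assms(3), of 2] power_mono[OF assms(1), of 2] power_mono[OF assms(2), of 2]
    by simp
  finally show ?thesis by simp
qed

lemma eq_zero_if_norm_add_sub_le:
  fixes v w :: complex
  assumes "cmod (v + w) \<le> R" "cmod (v - w) \<le> R" "cmod v = R"
  shows "w = 0"
proof -
  have "2 * (cmod w)\<^sup>2 = (cmod (v + w))\<^sup>2 + (cmod (v - w))\<^sup>2 - 2 * (cmod v)\<^sup>2"
    unfolding cmod_power2 by (simp add: power2_eq_square algebra_simps)
  also have "\<dots> \<le> R\<^sup>2 + R\<^sup>2 - 2 * R\<^sup>2"
    using power_mono[OF assms(1), of 2] power_mono[OF assms(2), of 2] assms(3) by simp
  finally show ?thesis by simp
qed

text \<open>At a suitable \<open>y\<close>, \<open>L f y\<close> depends only on \<open>f x\<close>: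
  constants are mapped there by a plane isometry, and functions vanishing at \<open>x\<close> are
  sent to 0. As \<open>L\<close> is only real linear, the values 1 and \<open>\<i>\<close> are
  treated separately.\<close>

lemma linear_isometry_modulus_point:
  fixes L :: "'x::{first_countable_topology, t2_space} C \<Rightarrow> 'y::{first_countable_topology, t2_space} C"
  assumes compX: "compact (UNIV :: 'x set)" and compY: "compact (UNIV :: 'y set)"
    and lin: "linear L" and norm: "\<And>f. norm (L f) = norm f" and surj: "surj L"
  shows "\<exists>y. \<forall>f. cmod (L f y) = cmod (f x)"
proof -
  have inv: "L (inv L g) = g" for g
    by (rule surj_f_inv_f[OF surj])
  have norm_inv: "norm (inv L g) = norm g" for g
    using norm[of "inv L g"] by (simp add: inv)
  have norm_add: "norm (L f + g) = norm (f + inv L g)" for f g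
    using norm[of "f + inv L g"] by (simp add: linear_add[OF lin] inv)
  \<comment> \<open>\<open>L p\<close> peaks at some \<open>y\<close> for a peak function \<open>p\<close> at \<open>x\<close>; any \<open>q\<close> agreeing with it there adds up
    with \<open>L p\<close> to norm 2, which forces the preimage of \<open>q\<close> to attain its norm at \<open>x\<close>.\<close>
  have ex_dual: "\<exists>y u. cmod u = 1 \<and> (\<forall>q. norm q \<le> 1 \<longrightarrow> apply_bcontfun q y = u \<longrightarrow> inv L q x = l)"
    if l: "cmod l = 1" for l
  proof -
    obtain p :: "'x C" where px: "p x = l" and "norm p = 1"
      and peak: "\<And>z. 1 \<le> cmod (p z) \<Longrightarrow> z = x"
      using ex_peak_function[OF compX l, of x] by blast
    then have p_le: "cmod (p z) \<le> 1" for z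
      by (metis norm_bounded)
    have Lp: "norm (L p) = 1" using \<open>norm p = 1\<close> by (simp add: norm)
    obtain y where y: "cmod (L p y) = 1"
      using norm_attained[OF compY, of "L p"] Lp by metis
    have "inv L q x = l" if q: "norm q \<le> 1" "apply_bcontfun q y = L p y" for q
    proof -
      have "2 = cmod ((L p + q) y)"
        using y q(2) by (simp flip: mult_2 add: norm_mult)
      also have "\<dots> \<le> norm (p + inv L q)"
        using norm_bounded[of "L p + q" y] by (simp only: norm_add)
      finally obtain z where z: "2 \<le> cmod (p z + inv L q z)"
        using norm_attained[OF compX, of "p + inv L q"] by (metis plus_bcontfun.rep_eq)
      have q1: "cmod (inv L q z) \<le> 1"
        using norm_bounded[of "inv L q" z] q(1) by (simp add: norm_inv)
      with z have "1 \<le> cmod (p z)"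
        using norm_triangle_ineq[of "p z" "inv L q z"] by simp
      then have "z = x" by (rule peak)
      with eq_if_norm_add_ge_two[OF p_le q1 z] px show ?thesis by simp
    qed
    with y show ?thesis by blast
  qed
  obtain y1 u1 where 1: "cmod u1 = 1" "\<And>q. norm q \<le> 1 \<Longrightarrow> apply_bcontfun q y1 = u1 \<Longrightarrow> inv L q x = 1"
    using ex_dual[of 1] by auto
  obtain y2 u2 where 2: "cmod u2 = 1" "\<And>q. norm q \<le> 1 \<Longrightarrow> apply_bcontfun q y2 = u2 \<Longrightarrow> inv L q x = \<i>"
    using ex_dual[of \<i>] by auto
  \<comment> \<open>Otherwise the positive and negative parts of \<open>e\<close>, which runs from 1
    at \<open>y1\<close> to -1 at \<open>y2\<close>, give \<open>q1\<close> and \<open>q2\<close>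
    whose sum has norm at most 1, while its preimage takes the value \<open>1 + \<i>\<close> at
    \<open>x\<close>.\<close>
  have "y2 = y1"
  proof (rule ccontr)
    assume "y2 \<noteq> y1"
    obtain d1 :: "'y \<Rightarrow> real" where d1: "continuous_on UNIV d1" "\<And>y. 0 \<le> d1 y" "\<And>y. d1 y = 0 \<longleftrightarrow> y = y1"
      using ex_function_vanishing_only_at[OF compY, of y1] by blast
    obtain d2 :: "'y \<Rightarrow> real" where d2: "continuous_on UNIV d2" "\<And>y. 0 \<le> d2 y" "\<And>y. d2 y = 0 \<longleftrightarrow> y = y2"
      using ex_function_vanishing_only_at[OF compY, of y2] by blast
    have pos: "d1 y + d2 y > 0" for y
      using d1(2,3)[of y] d2(2,3)[of y] \<open>y2 \<noteq> y1\<close> by (metis add_nonneg_eq_0_iff add_nonneg_nonneg less_eq_real_def)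
    then have nz: "d1 y + d2 y \<noteq> 0" for y by (metis less_irrefl)
    define e where "e y = (d2 y - d1 y) / (d1 y + d2 y)" for y
    have e: "continuous_on UNIV e"
      unfolding e_def[abs_def] by (intro continuous_intros d1 d2) (simp add: nz)
    have e1: "\<bar>e y\<bar> \<le> 1" for y
      using pos[of y] d1(2)[of y] d2(2)[of y] by (simp add: e_def abs_if divide_simps)
    have ey: "e y1 = 1" "e y2 = -1"
      using d1(3)[of y1] d2(3)[of y1] d1(3)[of y2] d2(3)[of y2] \<open>y2 \<noteq> y1\<close>
      by (auto simp: e_def)
    define q1 where "q1 = Bcontfun (\<lambda>y. u1 * complex_of_real (max 0 (e y)))"
    define q2 where "q2 = Bcontfun (\<lambda>y. u2 * complex_of_real (max 0 (- e y)))"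
    have q: "q1 y = u1 * complex_of_real (max 0 (e y))" "q2 y = u2 * complex_of_real (max 0 (- e y))" for y
      unfolding q1_def q2_def by (subst apply_Bcontfun[OF compY], auto intro!: continuous_intros e)+
    have c: "cmod (q1 y) = max 0 (e y)" "cmod (q2 y) = max 0 (- e y)" for y
      unfolding q by (simp_all add: norm_mult 1(1) 2(1))
    have n: "norm q1 \<le> 1" "norm q2 \<le> 1"
      using e1 by (auto intro!: norm_bound simp: c abs_le_iff)
    have "cmod (q1 y + q2 y) \<le> 1" for y
      using norm_triangle_ineq[of "q1 y" "q2 y"] e1[of y] unfolding c by linarith
    then have "norm (q1 + q2) \<le> 1"
      by (intro norm_bound) simp
    then have "norm (inv L q1 + inv L q2) \<le> 1"
      using norm_add[of "inv L q1" q2] by (simp add: inv)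
    then have "cmod (1 + \<i>) \<le> 1"
      using norm_bounded[of "inv L q1 + inv L q2" x] 1(2)[OF n(1)] 2(2)[OF n(2)] ey by (simp add: q)
    then have "(cmod (1 + \<i>))\<^sup>2 \<le> 1" by (simp add: power_le_one)
    then show False by (simp add: cmod_power2)
  qed
  \<comment> \<open>The argument of \<open>ex_dual\<close> with the two spaces exchanged, using a
    peak function at \<open>y1\<close>.\<close>
  have dual_value: "L p y1 = u"
    if p: "norm p \<le> 1" "apply_bcontfun p x = l" and l: "cmod l = 1" and u: "cmod u = 1"
      and dual: "\<And>q. norm q \<le> 1 \<Longrightarrow> apply_bcontfun q y1 = u \<Longrightarrow> inv L q x = l" for p l u
  proof -
    obtain q :: "'y C" where qy: "q y1 = u" and qn: "norm q = 1"
      and peak: "\<And>z. 1 \<le> cmod (q z) \<Longrightarrow> z = y1"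
      using ex_peak_function[OF compY u, of y1] by blast
    have q_le: "cmod (q z) \<le> 1" for z
      using norm_bounded[of q z] by (simp add: qn)
    have "inv L q x = l"
      by (rule dual) (simp_all add: qn qy)
    then have "2 = cmod ((p + inv L q) x)"
      using p(2) l by (simp flip: mult_2 add: norm_mult)
    also have "\<dots> \<le> norm (L p + q)"
      using norm_bounded[of "p + inv L q" x] by (simp only: norm_add)
    finally obtain z where z: "2 \<le> cmod (L p z + q z)"
      using norm_attained[OF compY, of "L p + q"] by (metis plus_bcontfun.rep_eq)
    have p1: "cmod (L p z) \<le> 1"
      using norm_bounded[of "L p" z] p(1) by (simp add: norm)
    with z have "1 \<le> cmod (q z)"
      using norm_triangle_ineq[of "L p z" "q z"] by simp
    then have "z = y1" by (rule peak)
    with eq_if_norm_add_ge_two[OF p1 q_le z] qy show ?thesis by simp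
  qed
  have value1: "L p y1 = u1" if "norm p \<le> 1" "apply_bcontfun p x = 1" for p
    using dual_value[OF that _ 1(1)] 1(2) by simp
  have value2: "L p y1 = u2" if "norm p \<le> 1" "apply_bcontfun p x = \<i>" for p
    using dual_value[OF that _ 2(1)] 2(2) \<open>y2 = y1\<close> by simp
  define k :: "complex \<Rightarrow> 'x C" where "k c = const_bcontfun c" for c
  have k [simp]: "k c z = c" for c z by (simp add: k_def const_bcontfun.rep_eq)
  have Lk: "L (k c) y1 = Re c *\<^sub>R u1 + Im c *\<^sub>R u2" for c
  proof -
    have "k c = Re c *\<^sub>R k 1 + Im c *\<^sub>R k \<i>"
      by (rule bcontfun_eqI) (simp add: complex_eq_iff)
    moreover have "L (k 1) y1 = u1" "L (k \<i>) y1 = u2"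
      by (auto intro!: value1 value2 norm_bound)
    ultimately show ?thesis by (simp add: linear_add[OF lin] linear_scale[OF lin])
  qed
  \<comment> \<open>The bounds for \<open>1 + \<i>\<close> and \<open>1 - \<i>\<close> force the
    real inner product of the unit vectors \<open>u1\<close> and \<open>u2\<close> to be both
    nonpositive and nonnegative, so they are orthonormal.\<close>
  have orth: "cmod (Re c *\<^sub>R u1 + Im c *\<^sub>R u2) = cmod c" for c
  proof -
    have "cmod (Re c *\<^sub>R u1 + Im c *\<^sub>R u2) \<le> cmod c" for c
    proof -
      have "cmod (L (k c) y1) \<le> norm (k c)" by (metis norm_bounded norm)
      also have "\<dots> \<le> cmod c" by (simp add: norm_bound)
      finally show ?thesis by (simp add: Lk)
    qed
    from this[of "1 + \<i>"] this[of "1 - \<i>"]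
    have "cmod (u1 + u2) \<le> sqrt 2" "cmod (u1 - u2) \<le> sqrt 2"
      by (simp_all add: cmod_def[of "1 + \<i>"] cmod_def[of "1 - \<i>"])
    then have "(cmod (u1 + u2))\<^sup>2 \<le> 2" "(cmod (u1 - u2))\<^sup>2 \<le> 2"
      by (metis norm_ge_zero power_mono real_sqrt_pow2 zero_le_numeral)+
    moreover have "(Re u1)\<^sup>2 + (Im u1)\<^sup>2 = 1" "(Re u2)\<^sup>2 + (Im u2)\<^sup>2 = 1"
      using 1(1) 2(1) by (simp_all flip: cmod_power2)
    ultimately have o: "Re u1 * Re u2 + Im u1 * Im u2 = 0"
      unfolding cmod_power2 by (simp add: power2_eq_square algebra_simps)
    have "(cmod (Re c *\<^sub>R u1 + Im c *\<^sub>R u2))\<^sup>2 =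
        (Re c)\<^sup>2 * ((Re u1)\<^sup>2 + (Im u1)\<^sup>2) + (Im c)\<^sup>2 * ((Re u2)\<^sup>2 + (Im u2)\<^sup>2)
        + 2 * Re c * Im c * (Re u1 * Re u2 + Im u1 * Im u2)"
      unfolding cmod_power2 by (simp add: power2_eq_square algebra_simps)
    also have "\<dots> = (cmod c)\<^sup>2"
      using o \<open>(Re u1)\<^sup>2 + (Im u1)\<^sup>2 = 1\<close> \<open>(Re u2)\<^sup>2 + (Im u2)\<^sup>2 = 1\<close> by (simp add: cmod_power2)
    finally show ?thesis by simp
  qed
  have zero: "L f y1 = 0" if f: "apply_bcontfun f x = 0" for f
  proof -
    \<comment> \<open>The summand 1 keeps \<open>R\<close> positive. Below,
      \<open>R *\<^sub>R p\<close> has modulus \<open>R - cmod (f z)\<close>, leaving just enough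
      room to add or subtract \<open>f\<close> within norm \<open>R\<close>.\<close>
    define R where "R = norm f + 1"
    have R: "R > 0" "cmod (f z) \<le> R" for z
      using norm_bounded[of f z] norm_ge_zero[of f] unfolding R_def by linarith+
    define p where "p = Bcontfun (\<lambda>z. complex_of_real ((R - cmod (f z)) / R))"
    have p: "p z = complex_of_real ((R - cmod (f z)) / R)" for z
      unfolding p_def by (subst apply_Bcontfun[OF compX])
        (use R in \<open>auto intro!: continuous_intros\<close>)
    have pn: "R * cmod (p z) = R - cmod (f z)" for z
      unfolding p norm_of_real using R(1) R(2)[of z] by simp
    have "cmod (p z) \<le> 1" for z
      using pn[of z] R(1) norm_ge_zero[of "f z"] mult_le_cancel_left_pos[of R "cmod (p z)" 1]
      by linarith
    then have "L p y1 = u1"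
      using R(1) by (intro value1 norm_bound) (simp_all add: p f)
    then have "L (R *\<^sub>R p + f) y1 = R *\<^sub>R u1 + L f y1" "L (R *\<^sub>R p - f) y1 = R *\<^sub>R u1 - L f y1"
      by (simp_all add: linear_add[OF lin] linear_diff[OF lin] linear_scale[OF lin])
    moreover have "norm (R *\<^sub>R p + f) \<le> R" "norm (R *\<^sub>R p - f) \<le> R"
      using norm_triangle_ineq[of "R *\<^sub>R p z" "f z" for z] norm_triangle_ineq4[of "R *\<^sub>R p z" "f z" for z] R(1)
      by (auto intro!: norm_bound simp: pn)
    ultimately show ?thesis
      using eq_zero_if_norm_add_sub_le[of "R *\<^sub>R u1" "L f y1" R] R(1) 1(1)
        norm_bounded[of "L (R *\<^sub>R p + f)" y1] norm_bounded[of "L (R *\<^sub>R p - f)" y1]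
      by (simp add: norm)
  qed
  have "cmod (L f y1) = cmod (apply_bcontfun f x)" for f
  proof -
    have "L (f - k (f x)) y1 = 0" by (rule zero) simp
    then show ?thesis by (simp add: linear_diff[OF lin] Lk orth)
  qed
  then show ?thesis by blast
qed

lemma eq_if_all_moduli_eq:
  fixes x :: "'x::{first_countable_topology, t2_space}"
  assumes "compact (UNIV :: 'x set)" "\<And>f :: 'x C. cmod (f x) = cmod (f z)"
  shows "z = x"
proof -
  obtain d :: "'x \<Rightarrow> real" where d: "continuous_on UNIV d" "\<And>y. 0 \<le> d y" "\<And>y. d y = 0 \<longleftrightarrow> y = x"
    using ex_function_vanishing_only_at[OF assms(1), of x] by blast
  have "continuous_on UNIV (\<lambda>y. complex_of_real (d y))"
    by (intro continuous_intros d)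
  from assms(2)[of "Bcontfun (\<lambda>y. complex_of_real (d y))", unfolded apply_Bcontfun[OF assms(1) this]]
  have "d z = d x" using d(2) by simp
  then show ?thesis using d(3)[of x] d(3)[of z] by simp
qed

text \<open>The previous point lemma for \<open>inv L\<close> defines \<open>\<phi>\<close>, and for
  \<open>L\<close> shows it onto; injectivity holds because moduli separate points. Taking moduli
  removes the rotation or reflection of the plane acting at each \<open>y\<close>.\<close>

lemma Iso_modulus_composition:
  fixes S :: "'x::{first_countable_topology, t2_space} C \<Rightarrow> 'y::{first_countable_topology, t2_space} C"
  assumes compX: "compact (UNIV :: 'x set)" and compY: "compact (UNIV :: 'y set)"
    and S: "S \<in> Iso"
  shows "\<exists>\<phi>. bij \<phi> \<and> (\<forall>f g y. cmod (S f y - S g y) = cmod (f (\<phi> y) - g (\<phi> y)))"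
proof -
  define L where "L f = S f - S 0" for f
  have lin: "linear L" unfolding L_def[abs_def] by (rule Mazur_Ulam[OF S])
  have norm: "norm (L f) = norm f" for f
    using S by (metis L_def Iso_iff diff_zero dist_norm)
  have surj: "surj L"
  proof (rule surjI)
    show "L (inv S (g + S 0)) = g" for g
      using S by (simp add: L_def Iso_iff surj_f_inv_f)
  qed
  have inj: "inj L"
    using norm by (simp add: linear_injective_0[OF lin]) (metis norm_eq_zero)
  have inv: "inv L (L f) = f" for f using inj by simp
  have inv': "L (inv L g) = g" for g using surj by (rule surj_f_inv_f)
  have fwd: "\<exists>y. \<forall>f. cmod (L f y) = cmod (f x)" for x
    by (rule linear_isometry_modulus_point[OF compX compY lin norm surj])
  have "linear (inv L)"
  proof (rule linearI)
    show "inv L (g + h) = inv L g + inv L h" for g h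
      using inv[of "inv L g + inv L h"] by (simp add: linear_add[OF lin] inv')
    show "inv L (r *\<^sub>R g) = r *\<^sub>R inv L g" for r g
      using inv[of "r *\<^sub>R inv L g"] by (simp add: linear_scale[OF lin] inv')
  qed
  moreover have "norm (inv L g) = norm g" for g
    using norm[of "inv L g"] by (simp add: inv')
  moreover have "surj (inv L)" using inj by (rule inj_imp_surj_inv)
  ultimately have "\<exists>x. \<forall>g. cmod (inv L g x) = cmod (g y)" for y
    by (intro linear_isometry_modulus_point[OF compY compX])
  then have "\<exists>x. \<forall>f. cmod (apply_bcontfun f x) = cmod (L f y)" for y
    by (metis inv)
  then obtain \<phi> where \<phi>: "\<And>y f. cmod (apply_bcontfun f (\<phi> y)) = cmod (L f y)" by metis
  have "surj \<phi>"
  proof -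
    have "\<exists>y. \<phi> y = x" for x
    proof -
      obtain y where "\<And>f. cmod (L f y) = cmod (apply_bcontfun f x)" using fwd[of x] by blast
      then have "\<phi> y = x" by (intro eq_if_all_moduli_eq[OF compX]) (simp add: \<phi>)
      then show ?thesis ..
    qed
    then show ?thesis unfolding surj_def by metis
  qed
  moreover have "inj \<phi>"
  proof (rule injI)
    fix y z assume "\<phi> y = \<phi> z"
    then have "cmod (L f y) = cmod (L f z)" for f by (simp flip: \<phi>)
    then have "cmod (g y) = cmod (g z)" for g :: "'y C" by (metis inv')
    then show "y = z" by (intro eq_if_all_moduli_eq[OF compY]) simp
  qed
  moreover have "cmod (S f y - S g y) = cmod (f (\<phi> y) - g (\<phi> y))" for f g y
  proof -
    have "S f y - S g y = L (f - g) y" by (simp add: linear_diff[OF lin]) (simp add: L_def)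
    then show ?thesis by (simp flip: \<phi>)
  qed
  ultimately show ?thesis unfolding bij_def by blast
qed

subsection \<open>2-local isometries\<close>

theorem corollary10:
  fixes T :: "'x::{first_countable_topology, t2_space} C \<Rightarrow>
              'y::{first_countable_topology, t2_space} C"
  assumes "compact (UNIV :: 'x set)"
    and "compact (UNIV :: 'y set)"
    and "two_local_in Iso T"
  shows "T \<in> Iso"
proof -
  note compX = assms(1) and compY = assms(2)
  have pair: "\<exists>\<phi>. bij \<phi> \<and> (\<forall>y. cmod (T f y - T g y) = cmod (f (\<phi> y) - g (\<phi> y)))" for f g
  proof -
    obtain S where "S \<in> Iso" "T f = S f" "T g = S g"
      using assms(3) unfolding two_local_in_def by metis
    with Iso_modulus_composition[OF compX compY, of S] show ?thesis by metis
  qed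
  \<comment> \<open>Normalising the functional \<open>f \<mapsto> T f y\<close> by the plane isometry \<open>A y\<close> makes it fix the constants.\<close>
  define A where "A y c = T (const_bcontfun c) y" for y c
  have A_iso: "dist (A y c) (A y c') = dist c c'" for y c c'
    using pair[of "const_bcontfun c" "const_bcontfun c'"]
    by (auto simp: A_def dist_norm const_bcontfun.rep_eq)
  \<comment> \<open>Up to a translation \<open>A y\<close> is an orthogonal transformation of the
    plane, hence onto.\<close>
  have A_inv: "A y (inv (A y) w) = w" for y w
  proof -
    have "orthogonal_transformation (\<lambda>c. A y c - A y 0)"
      by (simp add: orthogonal_transformation_isometry) (use A_iso in \<open>simp add: dist_norm\<close>)
    then have "surj (\<lambda>c. A y c - A y 0)" by (rule orthogonal_transformation_surj)
    then obtain c where "w - A y 0 = A y c - A y 0" by (rule surjE)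
    then have "w \<in> range (A y)" by auto
    then show ?thesis by (rule f_inv_into_f)
  qed
  have "\<exists>x. \<forall>f. T f y = A y (f x)" for y
  proof -
    \<comment> \<open>For discontinuous \<open>f\<close> the value \<open>Bcontfun f\<close> is
      unspecified, so \<open>sph\<close> is claimed for continuous functions only.\<close>
    define F where "F f = inv (A y) (T (Bcontfun f) y)" for f
    have AF: "A y (F f) = T (Bcontfun f) y" for f
      unfolding F_def by (rule A_inv)
    have const: "F (\<lambda>_. c) = c" for c
    proof -
      have "Bcontfun (\<lambda>_ :: 'x. c) = const_bcontfun c"
        by (simp add: const_bcontfun_def)
      then have "A y (F (\<lambda>_. c)) = A y c" using AF[of "\<lambda>_. c"] by (simp add: A_def)
      then show ?thesis using A_iso[of y "F (\<lambda>_. c)" c] by simp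
    qed
    have sph: "\<exists>x. cmod (F f - F g) = cmod (f x - g x)"
      if "continuous_on UNIV f" "continuous_on UNIV g" for f g
    proof -
      have "cmod (F f - F g) = cmod (T (Bcontfun f) y - T (Bcontfun g) y)"
        using A_iso[of y "F f" "F g"] by (simp add: AF dist_norm)
      then show ?thesis
        using pair[of "Bcontfun f" "Bcontfun g"] that by (auto simp: apply_Bcontfun[OF compX])
    qed
    obtain x where x: "\<And>f. continuous_on UNIV f \<Longrightarrow> F f = f x"
      using range_condition_imp_evaluation[OF compX const
          spherical_range_imp_range[OF compX const sph]] by blast
    have "T f y = A y (f x)" for f
      using AF[of "apply_bcontfun f"] x[of "apply_bcontfun f"] by (simp add: apply_bcontfun_inverse)
    then show ?thesis by blast
  qed
  then obtain \<phi> where \<phi>: "\<And>y f. T f y = A y (apply_bcontfun f (\<phi> y))" by metis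
  have T_dist: "cmod (T f y - T g y) = cmod (f (\<phi> y) - g (\<phi> y))" for f g y
    using A_iso[of y "f (\<phi> y)" "g (\<phi> y)"] by (simp add: \<phi> dist_norm)
  have "\<forall>x. \<exists>d :: 'x \<Rightarrow> real. continuous_on UNIV d \<and> (\<forall>z. 0 \<le> d z) \<and> (\<forall>z. d z = 0 \<longleftrightarrow> z = x)"
  proof
    fix x :: 'x
    obtain d :: "'x \<Rightarrow> real" where "continuous_on UNIV d" "\<And>z. 0 \<le> d z" "\<And>z. d z = 0 \<longleftrightarrow> z = x"
      using ex_function_vanishing_only_at[OF compX, of x] by blast
    then show "\<exists>d :: 'x \<Rightarrow> real. continuous_on UNIV d \<and> (\<forall>z. 0 \<le> d z) \<and> (\<forall>z. d z = 0 \<longleftrightarrow> z = x)"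
      by (intro exI[of _ d]) simp
  qed
  from choice[OF this] obtain d :: "'x \<Rightarrow> 'x \<Rightarrow> real"
    where "\<forall>x. continuous_on UNIV (d x) \<and> (\<forall>z. 0 \<le> d x z) \<and> (\<forall>z. d x z = 0 \<longleftrightarrow> z = x)"
    by (rule exE)
  then have d: "continuous_on UNIV (d x)" "0 \<le> d x z" "d x z = 0 \<longleftrightarrow> z = x" for x z
    by auto
  define p where "p x = Bcontfun (\<lambda>z. complex_of_real (d x z))" for x
  have p: "p x z = complex_of_real (d x z)" for x z
    unfolding p_def by (subst apply_Bcontfun[OF compX]) (auto intro!: continuous_intros d(1))
  \<comment> \<open>Written through \<open>T\<close>, this function is visibly continuous; it equals
    \<open>d x\<close> after \<open>\<phi>\<close>, whose continuity is still open.\<close>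
  define D where "D x y = cmod (T (p x) y - T 0 y)" for x y
  have D: "D x y = d x (\<phi> y)" for x y
    using T_dist[of "p x" y 0] d(2) by (simp add: D_def p)
  have D_cont: "continuous_on UNIV (D x)" for x
    unfolding D_def[abs_def] by (intro continuous_intros) auto
  \<comment> \<open>The bijection \<open>\<psi>\<close> belonging to the pair \<open>p x\<close>, 0
    may vary with \<open>x\<close>, but \<open>d x\<close> vanishes only at \<open>x\<close>, so
    \<open>\<psi>\<close> and \<open>\<phi>\<close> have the same fibre over
    \<open>x\<close>.\<close>
  have "\<exists>!y. \<phi> y = x" for x
  proof -
    obtain \<psi> where \<psi>: "bij \<psi>" "\<And>y. D x y = d x (\<psi> y)"
      using pair[of "p x" 0] d(2) by (auto simp: D_def p)
    have "\<exists>!y. \<psi> y = x"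
      using \<psi>(1) by (metis bij_pointE)
    moreover have "\<psi> y = x \<longleftrightarrow> \<phi> y = x" for y
      using \<psi>(2)[of y] D[of x y] d(3)[of x] by metis
    ultimately show ?thesis by simp
  qed
  then have bij: "bij \<phi>"
    unfolding bij_def inj_def surj_def by metis
  have cont: "continuous_on UNIV \<phi>"
    unfolding continuous_on_def
  proof (intro ballI topological_tendstoI)
    fix y U assume U: "open U" "\<phi> y \<in> U"
    let ?D = "D (\<phi> y)"
    \<comment> \<open>The bound \<open>e\<close> is the minimum of \<open>d (\<phi> y)\<close> on
      the compact complement of \<open>U\<close>, which must be nonempty.\<close>
    have "\<exists>e>0. \<forall>z. ?D z < e \<longrightarrow> \<phi> z \<in> U"
    proof (cases "U = UNIV")
      case False
      have "compact (- U)"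
        using compact_Int_closed[OF compX, of "- U"] U(1) by (simp add: closed_Compl)
      moreover have "- U \<noteq> {}" using False by blast
      ultimately obtain m where m: "m \<in> - U" "\<forall>z\<in>- U. d (\<phi> y) m \<le> d (\<phi> y) z"
        using continuous_attains_inf[OF _ _ continuous_on_subset[OF d(1) subset_UNIV]] by blast
      then have "m \<noteq> \<phi> y" using U(2) by blast
      then have "0 < d (\<phi> y) m"
        using d(2)[of "\<phi> y" m] d(3)[of "\<phi> y" m] by linarith
      moreover have "\<phi> z \<in> U" if "?D z < d (\<phi> y) m" for z
        using m(2) that unfolding D by (meson ComplI linorder_not_less)
      ultimately show ?thesis by blast
    qed (auto intro: exI[of _ 1])
    then obtain e where e: "e > 0" "\<And>z. ?D z < e \<Longrightarrow> \<phi> z \<in> U" by blast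
    have "(?D \<longlongrightarrow> ?D y) (at y)"
      using D_cont by (simp add: continuous_on_def)
    moreover have "?D y = 0" by (simp add: D d(3))
    ultimately have "eventually (\<lambda>z. ?D z < e) (at y)"
      using e(1) by (auto dest: order_tendstoD(2))
    then show "eventually (\<lambda>z. \<phi> z \<in> U) (at y within UNIV)"
      by (auto elim: eventually_mono intro: e(2))
  qed
  have cont_inv: "continuous_on UNIV (inv \<phi>)"
    using continuous_on_inv[OF cont compY, of "inv \<phi>"] bij by (simp add: bij_is_inj bij_is_surj)
  have "surj T"
  proof (rule surjI)
    fix g :: "'y C"
    define b where "b y = inv (A y) (g y)" for y
    have Ab: "A y (b y) = g y" for y
      unfolding b_def by (rule A_inv)
    have b: "continuous_on UNIV b"
      unfolding continuous_on_def
    proof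
      fix y
      \<comment> \<open>The image \<open>a\<close> of the constant \<open>b y\<close> is continuous
        and agrees with \<open>g\<close> at \<open>y\<close>; since \<open>A z\<close> is an
        isometry, \<open>b z\<close> is as far from \<open>b y\<close> as \<open>g z\<close> is from
        \<open>a z\<close>.\<close>
      define a where "a = T (const_bcontfun (b y))"
      have "dist (b z) (b y) = dist (g z) (a z)" for z
        using A_iso[of z "b z" "b y"] by (simp add: Ab) (simp add: A_def a_def)
      moreover have "((\<lambda>z. dist (g z) (a z)) \<longlongrightarrow> dist (g y) (a y)) (at y)"
        using continuous_on_apply_bcontfun[of UNIV g] continuous_on_apply_bcontfun[of UNIV a]
        by (intro tendsto_dist) (auto simp: continuous_on_def simp del: continuous_on_apply_bcontfun)
      moreover have "a y = g y" using Ab[of y] by (simp add: A_def a_def)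
      ultimately show "(b \<longlongrightarrow> b y) (at y within UNIV)"
        by (subst tendsto_dist_iff) simp
    qed
    have "continuous_on UNIV (\<lambda>x. b (inv \<phi> x))"
      using continuous_on_compose2[OF b cont_inv] by simp
    then show "T (Bcontfun (\<lambda>x. b (inv \<phi> x))) = g"
      using bij by (intro bcontfun_eqI) (simp add: \<phi> apply_Bcontfun[OF compX] bij_is_inj Ab)
  qed
  moreover have "dist (T f) (T g) = dist f g" for f g
  proof -
    obtain S where "S \<in> Iso" "T f = S f" "T g = S g"
      using assms(3) unfolding two_local_in_def by metis
    then show ?thesis by (simp add: Iso_iff)
  qed
  ultimately show ?thesis by (simp add: Iso_iff)
qed

end
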